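(* Let $K$ be the locally compact, second countable topological group of permutations of $\mathbb{N}$ constructed from a partition $\mathcal{J}=\{J_i\}$ of $\mathbb{N}$ as in the context, with the sets $K(\pi)$ and $G(\pi)$ defined there. For each $n\ge 1$ and each $\pi\in S^n$, $G(\pi)$ is an open, dense, conjugation-invariant subset of $K$. The dense $G_\delta$ set $$\mathcal{T}=\bigcap_{\pi}G(\pi)$$ (intersection over all $\pi\in\bigcup_{n\ge1}S^n$) is exactly the set of transitive points for the conjugation action of $K$ on itself, i.e. the set of $a\in K$ whose conjugacy class is dense in $K$. In addition, if $a\in K$ and for every $n$ and every $\pi\in S^n$ the element $a$ contains a copy of $\pi$, then $a\in\mathcal{T}$. In particular, $K$ satisfies the Rohlin Property, i.e. $K$ has a dense conjugacy class.
   Context: Let $\mathcal{J}=\{J_i:i=1,2,\dots\}$ be a sequence of nonempty finite subsets of $\mathbb{N}$ with strictly increasing cardinalities which together partition $\mathbb{N}$. Put $J^n=\bigcup_{i=1}^n J_i$. Let $S_i$ be the group of permutations of $J_i$ and $S^n$ the group of permutations of $J^n$. For $n\ge1$ let $$K_n=S^n\times S_{n+1}\times S_{n+2}\times\cdots$$ with the product topology (of finite discrete groups). Via concatenation of permutations, $K_n$ is identified with the group of those permutations of $\mathbb{N}$ that map $J^n$ to itself and map $J_i$ to itself for each $i>n$. Then $K_n$ is a clopen subgroup of the compact metrizable group $K_{n+1}$. Let $K=\bigcup_n K_n$ (a group of permutations of $\mathbb{N}$) with the inductive topology: $A\subset K$ is open iff $A\cap K_n$ is open in $K_n$ for every $n$.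 With this topology $K$ is a locally compact, second countable, metrizable topological group. For $a\in K_n$, $a^{(n)}\in S^n$ denotes the restriction of $a$ to $J^n$. For $\pi\in S^n$, $$K(\pi)=\{a\in K_n:a^{(n)}=\pi\},\qquad G(\pi)=\bigcup_{b\in K}bK(\pi)b^{-1}.$$ For $\pi\in S^n$ and $a\in K$, $a$ contains a copy of $\pi$ if there exist $k\ge1$ and an injection $\beta:J^n\to J_{n+k}$ such that $\beta\circ\pi=a\circ\beta$ on $J^n$. *)

theory Defs
  imports "HOL-Analysis.Analysis" "HOL-Combinatorics.Orbits"
begin

definition dense_in :: "'a topology \<Rightarrow> 'a set \<Rightarrow> bool" where
  "dense_in X A \<longleftrightarrow> A \<subseteq> topspace X \<and> X closure_of A = topspace X"

definition transitive_points :: "'a topology \<Rightarrow> 'g set \<Rightarrow> ('g \<Rightarrow> 'a \<Rightarrow> 'a) \<Rightarrow> 'a set" where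
  "transitive_points X \<Gamma> act = {x \<in> topspace X. dense_in X ((\<lambda>g. act g x) ` \<Gamma>)}"

text \<open>The blocks of the partition are \<open>J 1, J 2, \<dots>\<close>; the value \<open>J 0\<close> is never used.\<close>

definition block_partition :: "(nat \<Rightarrow> nat set) \<Rightarrow> bool" where
  "block_partition J \<longleftrightarrow>
     (\<forall>i\<ge>1. finite (J i) \<and> J i \<noteq> {}) \<and>
     (\<forall>i\<ge>1. card (J i) < card (J (Suc i))) \<and>
     disjoint_family_on J {1..} \<and>
     (\<Union>i\<in>{1..}. J i) = UNIV"

definition J_upto :: "(nat \<Rightarrow> nat set) \<Rightarrow> nat \<Rightarrow> nat set" where
  "J_upto J n = (\<Union>i\<in>{1..n}. J i)"

text \<open>
  A permutation of a subset of \<open>nat\<close> is represented by its extension by the identity. Since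
  the same function can thus represent elements of \<open>S_upto J n\<close> for several \<open>n\<close>, the level \<open>n\<close>
  is an explicit argument wherever it matters.
\<close>

definition S_upto :: "(nat \<Rightarrow> nat set) \<Rightarrow> nat \<Rightarrow> (nat \<Rightarrow> nat) set" where
  "S_upto J n = {\<pi>. \<pi> permutes J_upto J n}"

definition Kn :: "(nat \<Rightarrow> nat set) \<Rightarrow> nat \<Rightarrow> (nat \<Rightarrow> nat) set" where
  "Kn J n = {a. bij a \<and> a ` J_upto J n = J_upto J n \<and> (\<forall>i>n. a ` J i = J i)}"

definition K :: "(nat \<Rightarrow> nat set) \<Rightarrow> (nat \<Rightarrow> nat) set" where
  "K J = (\<Union>n\<in>{1..}. Kn J n)"

text \<open>
  The topology of \<open>Kn J n\<close> is that of the product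
  \<open>S\<^sup>n \<times> S\<^sub>n\<^sub>+\<^sub>1 \<times> S\<^sub>n\<^sub>+\<^sub>2 \<times> \<dots>\<close> of finite discrete spaces. The factors are indexed by
  \<open>{n..}\<close>, the factor with index \<open>n\<close> being \<open>S\<^sup>n\<close>. The lemma \<open>homeomorphic_map_Kn\<close> below confirms
  that restricting to the blocks identifies the two spaces.
\<close>

definition Kn_block :: "(nat \<Rightarrow> nat set) \<Rightarrow> nat \<Rightarrow> nat \<Rightarrow> nat set" where
  "Kn_block J n i = (if i = n then J_upto J n else J i)"

definition Kn_product :: "(nat \<Rightarrow> nat set) \<Rightarrow> nat \<Rightarrow> (nat \<Rightarrow> nat \<Rightarrow> nat) topology" where
  "Kn_product J n = product_topology (\<lambda>i. discrete_topology {p. p permutes Kn_block J n i}) {n..}"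

definition Kn_components :: "(nat \<Rightarrow> nat set) \<Rightarrow> nat \<Rightarrow> (nat \<Rightarrow> nat) \<Rightarrow> nat \<Rightarrow> nat \<Rightarrow> nat" where
  "Kn_components J n a = (\<lambda>i\<in>{n..}. perm_restrict a (Kn_block J n i))"

definition Kn_topology :: "(nat \<Rightarrow> nat set) \<Rightarrow> nat \<Rightarrow> (nat \<Rightarrow> nat) topology" where
  "Kn_topology J n = pullback_topology (Kn J n) (Kn_components J n) (Kn_product J n)"

definition K_topology :: "(nat \<Rightarrow> nat set) \<Rightarrow> (nat \<Rightarrow> nat) topology" where
  "K_topology J =
     topology (\<lambda>A. A \<subseteq> K J \<and> (\<forall>n\<ge>1. openin (Kn_topology J n) (A \<inter> Kn J n)))"

definition conj_by :: "(nat \<Rightarrow> nat) \<Rightarrow> (nat \<Rightarrow> nat) \<Rightarrow> nat \<Rightarrow> nat" where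
  "conj_by b a = b \<circ> a \<circ> inv b"

definition K_cyl :: "(nat \<Rightarrow> nat set) \<Rightarrow> nat \<Rightarrow> (nat \<Rightarrow> nat) \<Rightarrow> (nat \<Rightarrow> nat) set" where
  "K_cyl J n \<pi> = {a \<in> Kn J n. perm_restrict a (J_upto J n) = \<pi>}"

definition G_cyl :: "(nat \<Rightarrow> nat set) \<Rightarrow> nat \<Rightarrow> (nat \<Rightarrow> nat) \<Rightarrow> (nat \<Rightarrow> nat) set" where
  "G_cyl J n \<pi> = (\<Union>b\<in>K J. conj_by b ` K_cyl J n \<pi>)"

definition contains_copy :: "(nat \<Rightarrow> nat set) \<Rightarrow> nat \<Rightarrow> (nat \<Rightarrow> nat) \<Rightarrow> (nat \<Rightarrow> nat) \<Rightarrow> bool" where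
  "contains_copy J n a \<pi> \<longleftrightarrow>
     (\<exists>k\<ge>1. \<exists>\<beta>. inj_on \<beta> (J_upto J n) \<and> \<beta> ` J_upto J n \<subseteq> J (n + k) \<and>
                (\<forall>x\<in>J_upto J n. \<beta> (\<pi> x) = a (\<beta> x)))"

definition T_set :: "(nat \<Rightarrow> nat set) \<Rightarrow> (nat \<Rightarrow> nat) set" where
  "T_set J = (\<Inter>n\<in>{1..}. \<Inter>\<pi>\<in>S_upto J n. G_cyl J n \<pi>)"

definition rohlin_property :: "(nat \<Rightarrow> nat set) \<Rightarrow> bool" where
  "rohlin_property J \<longleftrightarrow> (\<exists>a\<in>K J. dense_in (K_topology J) ((\<lambda>b. conj_by b a) ` K J))"


lemma openin_K_topology:
  "openin (K_topology J) A \<longleftrightarrow>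
     A \<subseteq> K J \<and> (\<forall>n\<ge>1. openin (Kn_topology J n) (A \<inter> Kn J n))"
proof -
  have "istopology (\<lambda>A. A \<subseteq> K J \<and> (\<forall>n\<ge>1. openin (Kn_topology J n) (A \<inter> Kn J n)))"
    unfolding istopology_def
  proof (intro conjI allI impI)
    fix S T n
    assume S: "S \<subseteq> K J \<and> (\<forall>n\<ge>1. openin (Kn_topology J n) (S \<inter> Kn J n))"
      and T: "T \<subseteq> K J \<and> (\<forall>n\<ge>1. openin (Kn_topology J n) (T \<inter> Kn J n))"
    show "S \<inter> T \<subseteq> K J" using S by auto
    assume "1 \<le> (n::nat)"
    then have "openin (Kn_topology J n) ((S \<inter> Kn J n) \<inter> (T \<inter> Kn J n))"
      using S T openin_Int by blast
    moreover have "(S \<inter> Kn J n) \<inter> (T \<inter> Kn J n) = S \<inter> T \<inter> Kn J n" by auto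
    ultimately show "openin (Kn_topology J n) (S \<inter> T \<inter> Kn J n)" by simp
  next
    fix \<K> n
    assume *: "\<forall>S\<in>\<K>. S \<subseteq> K J \<and> (\<forall>n\<ge>1. openin (Kn_topology J n) (S \<inter> Kn J n))"
    show "\<Union>\<K> \<subseteq> K J" using * by auto
    assume "1 \<le> (n::nat)"
    then have "openin (Kn_topology J n) (\<Union>S\<in>\<K>. S \<inter> Kn J n)"
      using * by (intro openin_Union) blast
    moreover have "(\<Union>S\<in>\<K>. S \<inter> Kn J n) = \<Union>\<K> \<inter> Kn J n" by auto
    ultimately show "openin (Kn_topology J n) (\<Union>\<K> \<inter> Kn J n)" by simp
  qed
  then show ?thesis
    unfolding K_topology_def by simp
qed

lemma perm_restrict_permutes:
  assumes "bij a" "a ` B = B"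
  shows "perm_restrict a B permutes B"
proof (rule bij_imp_permutes)
  have "bij_betw a B B" using assms by (metis bij_betw_def inj_on_subset subset_UNIV)
  then show "bij_betw (perm_restrict a B) B B"
    by (subst bij_betw_cong[where g = a]) (auto simp: perm_restrict_def)
qed (auto simp: perm_restrict_def)

lemma Kn_components_in_product:
  assumes "a \<in> Kn J n"
  shows "Kn_components J n a \<in> topspace (Kn_product J n)"
proof -
  have "perm_restrict a (Kn_block J n i) permutes Kn_block J n i" if "i \<ge> n" for i
    using assms that by (intro perm_restrict_permutes) (auto simp: Kn_def Kn_block_def)
  then show ?thesis by (simp add: Kn_components_def Kn_product_def)
qed

lemma topspace_Kn_topology: "topspace (Kn_topology J n) = Kn J n"
  using Kn_components_in_product by (auto simp: Kn_topology_def topspace_pullback_topology)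

lemma topspace_K_topology: "topspace (K_topology J) = K J"
proof
  show "topspace (K_topology J) \<subseteq> K J"
    using openin_K_topology[of J "topspace (K_topology J)"] by simp
  have "K J \<inter> Kn J n = Kn J n" if "n \<ge> 1" for n
    using that by (auto simp: K_def)
  then have "openin (K_topology J) (K J)"
    by (simp add: openin_K_topology) (metis openin_topspace topspace_Kn_topology)
  then show "K J \<subseteq> topspace (K_topology J)" by (rule openin_subset)
qed

lemma Kn_block_unique:
  assumes "block_partition J" "n \<ge> 1"
  shows "\<exists>!i. i \<ge> n \<and> x \<in> Kn_block J n i"
proof -
  have dis: "i = j" if "x \<in> J i" "x \<in> J j" "i \<ge> 1" "j \<ge> 1" for i j
    using assms(1) that unfolding block_partition_def disjoint_family_on_def
    by (metis IntI atLeast_iff empty_iff)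
  obtain i where i: "i \<ge> 1" "x \<in> J i"
    using assms(1) unfolding block_partition_def by (metis UNIV_I UN_iff atLeast_iff)
  show ?thesis
  proof (rule ex1I[of _ "max i n"])
    show "max i n \<ge> n \<and> x \<in> Kn_block J n (max i n)"
      using i by (auto simp: Kn_block_def J_upto_def max_def)
  next
    fix j assume j: "j \<ge> n \<and> x \<in> Kn_block J n j"
    show "j = max i n"
    proof (cases "j = n")
      case True
      then obtain l where "l \<in> {1..n}" "x \<in> J l" using j by (auto simp: Kn_block_def J_upto_def)
      then show ?thesis using dis[of l i] i True by auto
    next
      case False
      then have "x \<in> J j" using j by (simp add: Kn_block_def)
      then show ?thesis using dis[of j i] i j assms(2) by auto
    qed
  qed
qed

lemma homeomorphic_map_Kn:
  assumes J: "block_partition J" and n: "n \<ge> 1"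
  shows "homeomorphic_map (Kn_topology J n) (Kn_product J n) (Kn_components J n)"
proof (rule bijective_open_imp_homeomorphic_map)
  let ?f = "Kn_components J n" and ?T = "Kn_product J n" and ?B = "Kn_block J n"
  show cont: "continuous_map (Kn_topology J n) ?T ?f"
    unfolding Kn_topology_def continuous_map_def
    using Kn_components_in_product
    by (auto simp: topspace_pullback_topology openin_pullback_topology)
  show "inj_on ?f (topspace (Kn_topology J n))"
  proof (rule inj_onI, rule ext)
    fix a b x assume eq: "?f a = ?f b"
    obtain i where i: "i \<ge> n" "x \<in> ?B i" using Kn_block_unique[OF J n, of x] by auto
    then have "perm_restrict a (?B i) = perm_restrict b (?B i)"
      using fun_cong[OF eq, of i] by (simp add: Kn_components_def)
    then have "perm_restrict a (?B i) x = perm_restrict b (?B i) x" by simp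
    then show "a x = b x" using i by (simp add: perm_restrict_def)
  qed
  show surj: "?f ` topspace (Kn_topology J n) = topspace ?T"
  proof
    show "?f ` topspace (Kn_topology J n) \<subseteq> topspace ?T"
      using Kn_components_in_product by (auto simp: topspace_Kn_topology)
    show "topspace ?T \<subseteq> ?f ` topspace (Kn_topology J n)"
    proof
      fix p assume "p \<in> topspace ?T"
      then have p: "p i permutes ?B i" if "i \<ge> n" for i
        using that by (auto simp: Kn_product_def)
      have ext: "p \<in> extensional {n..}"
        using \<open>p \<in> topspace ?T\<close> by (simp add: Kn_product_def PiE_def)
      define idx where "idx x = (THE i. i \<ge> n \<and> x \<in> ?B i)" for x
      have idx: "idx x \<ge> n" "x \<in> ?B (idx x)" for x
        using theI'[OF Kn_block_unique[OF J n, of x]] by (auto simp: idx_def)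
      have idx_eq: "idx x = i" if "i \<ge> n" "x \<in> ?B i" for x i
        using Kn_block_unique[OF J n, of x] idx[of x] that by auto
      define a where "a x = p (idx x) x" for x
      have a_eq: "a x = p i x" if "i \<ge> n" "x \<in> ?B i" for x i
        using idx_eq[OF that] by (simp add: a_def)
      have img: "a ` ?B i = ?B i" if "i \<ge> n" for i
        using permutes_image[OF p[OF that]] a_eq[OF that] by (metis image_cong)
      have "inj a"
      proof (rule injI)
        fix x y assume xy: "a x = a y"
        have "a x \<in> ?B (idx x)" "a y \<in> ?B (idx y)" using img idx by blast+
        then have "idx x = idx y" using idx_eq idx xy by metis
        then have "p (idx x) x = p (idx x) y" using xy by (simp add: a_def)
        then show "x = y" using permutes_inj[OF p[OF idx(1)]] by (meson injD)
      qed
      moreover have "surj a"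
        using img idx by (metis UNIV_I image_iff surjI surj_def)
      ultimately have "bij a" by (simp add: bij_def)
      moreover have "a ` J_upto J n = J_upto J n" using img[of n] by (simp add: Kn_block_def)
      moreover have "a ` J i = J i" if "i > n" for i
        using img[of i] that by (simp add: Kn_block_def)
      ultimately have "a \<in> Kn J n" by (simp add: Kn_def)
      moreover have "?f a = p"
      proof
        fix i show "?f a i = p i"
        proof (cases "i \<ge> n")
          case True
          then show ?thesis
            using a_eq[OF True] permutes_not_in[OF p[OF True]]
            by (auto simp: Kn_components_def perm_restrict_def fun_eq_iff)
        next
          case False
          then show ?thesis using ext by (auto simp: Kn_components_def extensional_def)
        qed
      qed
      ultimately show "p \<in> ?f ` topspace (Kn_topology J n)"
        by (auto simp: topspace_Kn_topology)
    qed
  qed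
  show "open_map (Kn_topology J n) ?T ?f"
    unfolding open_map_def
  proof (intro allI impI)
    fix U assume "openin (Kn_topology J n) U"
    then obtain V where V: "openin ?T V" "U = ?f -` V \<inter> Kn J n"
      by (auto simp: Kn_topology_def openin_pullback_topology)
    have "V \<subseteq> ?f ` Kn J n"
      using surj openin_subset[OF V(1)] by (simp add: topspace_Kn_topology)
    then have "?f ` U = V" using V(2) by blast
    then show "openin ?T (?f ` U)" using V(1) by simp
  qed
qed

end

(* The sets K_cyl J N (perm_restrict a (J_upto J N)) with N large form a neighbourhood base at a,
   so conjugation by an element of K is open, and a lies in T_set exactly when its conjugacy class
   meets every basic open set. A copy of \<pi> inside a later block can be swapped with J_upto J n
   by an involution in K, which conjugates a into K_cyl J n \<pi>. Hence an element that acts on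
   suitable blocks as copies of every \<pi> lies in T_set. As T_set is conjugation invariant, it
   contains the dense class of this element, so it is itself dense; no Baire category argument
   is needed. *)
theory Submission
  imports Defs
begin

section \<open>The increasing chain of groups \<open>Kn\<close>, its union \<open>K\<close>, and
  conjugation\<close>

lemma J_upto_mono: "m \<le> n \<Longrightarrow> J_upto J m \<subseteq> J_upto J n"
  unfolding J_upto_def by (intro UN_mono) auto

lemma J_upto_split: "m \<le> n \<Longrightarrow> J_upto J n = J_upto J m \<union> (\<Union>i\<in>{m<..n}. J i)"
  by (fastforce simp: J_upto_def)

lemma J_subset_J_upto: "1 \<le> i \<Longrightarrow> i \<le> n \<Longrightarrow> J i \<subseteq> J_upto J n"
  by (auto simp: J_upto_def)

lemma Kn_mono:
  assumes "a \<in> Kn J m" "m \<le> n"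
  shows "a \<in> Kn J n"
proof -
  have "a ` J_upto J n = a ` J_upto J m \<union> (\<Union>i\<in>{m<..n}. a ` J i)"
    using assms(2) by (simp add: J_upto_split image_Un image_UN)
  also have "\<dots> = J_upto J n"
    using assms by (simp add: J_upto_split Kn_def)
  finally show ?thesis using assms by (simp add: Kn_def)
qed

lemma comp_image_eq: "f ` A = A \<Longrightarrow> g ` A = A \<Longrightarrow> (f \<circ> g) ` A = A"
  by (metis image_comp)

lemma Kn_comp: "a \<in> Kn J n \<Longrightarrow> b \<in> Kn J n \<Longrightarrow> a \<circ> b \<in> Kn J n"
  unfolding Kn_def mem_Collect_eq by (intro conjI allI impI bij_comp comp_image_eq; simp)

lemma Kn_inv: "a \<in> Kn J n \<Longrightarrow> inv a \<in> Kn J n"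
proof -
  assume a: "a \<in> Kn J n"
  have "inv a ` A = A" if "a ` A = A" for A
    using a that by (metis (lifting) Kn_def bij_def image_inv_f_f mem_Collect_eq)
  then show ?thesis using a by (simp add: Kn_def bij_imp_bij_inv)
qed

lemma conj_by_Kn: "a \<in> Kn J n \<Longrightarrow> b \<in> Kn J n \<Longrightarrow> conj_by b a \<in> Kn J n"
  unfolding conj_by_def by (intro Kn_comp Kn_inv)

lemma Kn_subset_K: "n \<ge> 1 \<Longrightarrow> Kn J n \<subseteq> K J"
  by (auto simp: K_def)

text \<open>By \<open>Kn_mono\<close> the levels increase, so the maximum of two levels serves both
  elements. This transfers the group laws from the \<open>Kn\<close> to \<open>K\<close>.\<close>

lemma K_common_level:
  assumes "a \<in> K J" "b \<in> K J"
  obtains n where "n \<ge> 1" "a \<in> Kn J n" "b \<in> Kn J n"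
proof -
  obtain k l where "k \<ge> 1" "a \<in> Kn J k" "l \<ge> 1" "b \<in> Kn J l"
    using assms by (auto simp: K_def)
  then show thesis using that[of "max k l"] Kn_mono max.cobounded1 max.cobounded2
    by (metis le_trans)
qed

lemma K_comp: "a \<in> K J \<Longrightarrow> b \<in> K J \<Longrightarrow> a \<circ> b \<in> K J"
  by (metis K_common_level Kn_comp Kn_subset_K subsetD)

lemma K_inv: "a \<in> K J \<Longrightarrow> inv a \<in> K J"
  by (metis K_common_level Kn_inv Kn_subset_K subsetD)

lemma K_bij: "a \<in> K J \<Longrightarrow> bij a"
  by (auto simp: K_def Kn_def)

lemma conj_by_K: "a \<in> K J \<Longrightarrow> b \<in> K J \<Longrightarrow> conj_by b a \<in> K J"
  unfolding conj_by_def by (intro K_comp K_inv)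

lemma conj_by_comp: "bij b \<Longrightarrow> bij c \<Longrightarrow> conj_by b (conj_by c a) = conj_by (b \<circ> c) a"
  by (simp add: conj_by_def o_inv_distrib bij_is_inj bij_is_surj comp_assoc)

lemma conj_by_inv_cancel: "bij b \<Longrightarrow> conj_by (inv b) (conj_by b a) = a"
  "bij b \<Longrightarrow> conj_by b (conj_by (inv b) a) = a"
  by (simp_all add: conj_by_def fun_eq_iff inv_inv_eq bij_is_inj surj_f_inv_f bij_is_surj)

section \<open>Cylinder sets and their dependence on the level\<close>

text \<open>Both restrictions are the identity outside \<open>J_upto J n\<close>, so comparing them
  amounts to comparing values on that set. Basic neighbourhoods are handled in this form from here
  on.\<close>

lemma mem_K_cyl_iff:
  "c \<in> K_cyl J n (perm_restrict a (J_upto J n)) \<longleftrightarrow>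
     c \<in> Kn J n \<and> (\<forall>x\<in>J_upto J n. c x = a x)"
  by (auto simp: K_cyl_def perm_restrict_def fun_eq_iff)

text \<open>Extension by the identity lets one function \<pi> name a cylinder at every level from
  \<open>m\<close> on.\<close>

lemma perm_restrict_S_upto:
  "\<pi> \<in> S_upto J m \<Longrightarrow> m \<le> n \<Longrightarrow> perm_restrict \<pi> (J_upto J n) = \<pi>"
  using J_upto_mono[of m n J]
  by (auto simp: S_upto_def perm_restrict_def fun_eq_iff permutes_def)

lemma S_upto_mono: "m \<le> n \<Longrightarrow> S_upto J m \<subseteq> S_upto J n"
  by (auto simp: S_upto_def intro: permutes_subset[OF _ J_upto_mono])

lemma perm_restrict_in_S_upto:
  "a \<in> Kn J n \<Longrightarrow> perm_restrict a (J_upto J n) \<in> S_upto J n"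
  by (simp add: S_upto_def Kn_def perm_restrict_permutes)

text \<open>An element \<open>c\<close> of the smaller cylinder preserves the blocks between
  \<open>m\<close> and \<open>n\<close> because it agrees there with \<open>a\<close>, and those
  beyond \<open>n\<close> because it lies in \<open>Kn J n\<close>. Hence \<open>c\<close> drops to
  level \<open>m\<close>.\<close>

lemma K_cyl_antimono:
  assumes "a \<in> Kn J m" "m \<le> n"
  shows "K_cyl J n (perm_restrict a (J_upto J n)) \<subseteq> K_cyl J m (perm_restrict a (J_upto J m))"
proof
  fix c assume "c \<in> K_cyl J n (perm_restrict a (J_upto J n))"
  then have c: "c \<in> Kn J n" "\<And>x. x \<in> J_upto J n \<Longrightarrow> c x = a x"
    by (auto simp: mem_K_cyl_iff)
  have sub: "J_upto J m \<subseteq> J_upto J n" using assms J_upto_mono by blast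
  have img: "c ` A = a ` A" if "A \<subseteq> J_upto J n" for A
    using c(2) that by (intro image_cong) auto
  have "c ` J i = J i" if "i > m" for i
  proof (cases "i \<le> n")
    case True
    then show ?thesis using img[of "J i"] J_subset_J_upto[of i n J] that assms
      by (simp add: Kn_def)
  next
    case False
    then show ?thesis using c by (simp add: Kn_def)
  qed
  then have "c \<in> Kn J m"
    using c(1) img[OF sub] assms by (simp add: Kn_def)
  then show "c \<in> K_cyl J m (perm_restrict a (J_upto J m))"
    using c(2) sub by (auto simp: mem_K_cyl_iff)
qed

text \<open>Since \<open>inv b\<close> preserves \<open>J_upto J n\<close>, the conjugate acts there
  in a way that depends only on the action of \<open>c\<close> on that set.\<close>

lemma conj_by_K_cyl:
  assumes "a \<in> Kn J n" "b \<in> Kn J n" "c \<in> K_cyl J n (perm_restrict a (J_upto J n))"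
  shows "conj_by b c \<in> K_cyl J n (perm_restrict (conj_by b a) (J_upto J n))"
proof -
  have "inv b ` J_upto J n = J_upto J n" using Kn_inv[OF assms(2)] by (simp add: Kn_def)
  then show ?thesis
    using assms unfolding mem_K_cyl_iff
    by (auto simp: conj_by_Kn) (auto simp: conj_by_def image_subset_iff dest: equalityD1)
qed

section \<open>The sets \<open>G_cyl\<close> under conjugation\<close>

text \<open>Conjugation by \<open>b\<close> sends the part of the union with index \<open>c\<close>
  to the part with index \<open>b \<circ> c\<close>; the reverse inclusion applies this to
  \<open>inv b\<close>.\<close>

lemma G_cyl_conj_invariant:
  assumes "b \<in> K J"
  shows "conj_by b ` G_cyl J n \<pi> = G_cyl J n \<pi>"
proof -
  have sub: "conj_by b ` G_cyl J n \<pi> \<subseteq> G_cyl J n \<pi>" if "b \<in> K J" for b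
  proof
    fix a assume "a \<in> conj_by b ` G_cyl J n \<pi>"
    then obtain c d where "c \<in> K J" "d \<in> K_cyl J n \<pi>" "a = conj_by b (conj_by c d)"
      by (auto simp: G_cyl_def)
    then show "a \<in> G_cyl J n \<pi>"
      using K_comp[OF that, of c] that by (auto simp: G_cyl_def conj_by_comp K_bij)
  qed
  have "G_cyl J n \<pi> \<subseteq> conj_by b ` G_cyl J n \<pi>"
  proof
    fix a assume "a \<in> G_cyl J n \<pi>"
    then have "conj_by (inv b) a \<in> G_cyl J n \<pi>" using sub[OF K_inv[OF assms]] by blast
    then show "a \<in> conj_by b ` G_cyl J n \<pi>"
      using conj_by_inv_cancel(2)[OF K_bij[OF assms], of a] by (metis imageI)
  qed
  with sub[OF assms] show ?thesis by blast
qed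

lemma G_cyl_subset_K: "n \<ge> 1 \<Longrightarrow> G_cyl J n \<pi> \<subseteq> K J"
  using Kn_subset_K[of n J] by (auto simp: G_cyl_def K_cyl_def intro!: conj_by_K)

text \<open>Passing to inverse conjugators turns membership into the condition that the conjugacy
  class of \<open>a\<close> meets the cylinder, which is the form that density requires.\<close>

lemma mem_G_cyl_iff:
  assumes "a \<in> K J"
  shows "a \<in> G_cyl J n \<pi> \<longleftrightarrow> (\<exists>b\<in>K J. conj_by b a \<in> K_cyl J n \<pi>)"
proof
  assume "a \<in> G_cyl J n \<pi>"
  then obtain b c where "b \<in> K J" "c \<in> K_cyl J n \<pi>" "a = conj_by b c"
    by (auto simp: G_cyl_def)
  then show "\<exists>b\<in>K J. conj_by b a \<in> K_cyl J n \<pi>"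
    by (intro bexI[of _ "inv b"]) (auto simp: conj_by_inv_cancel K_bij K_inv)
next
  assume "\<exists>b\<in>K J. conj_by b a \<in> K_cyl J n \<pi>"
  then obtain b where b: "b \<in> K J" "conj_by b a \<in> K_cyl J n \<pi>" by blast
  then have "conj_by (inv b) (conj_by b a) \<in> G_cyl J n \<pi>"
    using K_inv by (auto simp: G_cyl_def)
  then show "a \<in> G_cyl J n \<pi>" using b by (simp add: conj_by_inv_cancel K_bij)
qed

section \<open>Consequences of the partition axioms\<close>

context
  fixes J :: "nat \<Rightarrow> nat set"
  assumes J: "block_partition J"
begin

lemma J_disjoint: "1 \<le> i \<Longrightarrow> 1 \<le> j \<Longrightarrow> i \<noteq> j \<Longrightarrow> J i \<inter> J j = {}"
  using J by (auto simp: block_partition_def disjoint_family_on_def)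

lemma J_upto_disjoint: "n < i \<Longrightarrow> J_upto J n \<inter> J i = {}"
proof -
  assume "n < i"
  then have "J j \<inter> J i = {}" if "j \<in> {1..n}" for j using that by (intro J_disjoint) auto
  then show ?thesis unfolding J_upto_def by blast
qed

lemma finite_J_upto: "finite (J_upto J n)"
  using J by (auto simp: J_upto_def block_partition_def)

text \<open>The strictly increasing cardinalities enter here: blocks become large enough to hold a
  copy of any given finite permutation.\<close>

lemma le_card_J: "i \<ge> 1 \<Longrightarrow> i \<le> card (J i)"
proof (induction i rule: dec_induct)
  case base
  have "finite (J 1)" "J 1 \<noteq> {}" using J by (auto simp: block_partition_def)
  then show ?case by (simp add: Suc_le_eq card_gt_0_iff)
next
  case (step i)
  then have "card (J i) < card (J (Suc i))" using J by (auto simp: block_partition_def)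
  with step show ?case by simp
qed

lemma S_upto_subset_Kn: "S_upto J n \<subseteq> Kn J n"
proof
  fix \<pi> assume "\<pi> \<in> S_upto J n"
  then have \<pi>: "\<pi> permutes J_upto J n" by (simp add: S_upto_def)
  have "\<pi> ` J i = J i" if "i > n" for i
  proof -
    have "\<pi> x = x" if "x \<in> J i" for x
      using permutes_not_in[OF \<pi>] J_upto_disjoint[OF \<open>i > n\<close>] that by blast
    then show ?thesis by simp
  qed
  then show "\<pi> \<in> Kn J n"
    using \<pi> by (simp add: Kn_def permutes_bij permutes_image)
qed

text \<open>At level \<open>n\<close> the identity extension of \<pi> also prescribes trivial action
  on the blocks between \<open>m\<close> and \<open>n\<close>, so the cylinder shrinks.\<close>

lemma K_cyl_S_upto_antimono:
  assumes "\<pi> \<in> S_upto J m" "m \<le> n"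
  shows "K_cyl J n \<pi> \<subseteq> K_cyl J m \<pi>"
  using K_cyl_antimono[OF subsetD[OF S_upto_subset_Kn assms(1)] assms(2)] assms
  by (simp add: perm_restrict_S_upto)

lemma S_upto_in_K_cyl: "\<pi> \<in> S_upto J n \<Longrightarrow> \<pi> \<in> K_cyl J n \<pi>"
  using S_upto_subset_Kn by (auto simp: K_cyl_def perm_restrict_S_upto)

section \<open>Cylinders as neighbourhood bases, and openness of conjugation\<close>

text \<open>Under \<open>Kn_components\<close> the cylinder corresponds to the product box whose
  coordinates from \<open>m\<close> to \<open>n\<close> are fixed to those of \<open>a\<close> and
  whose later coordinates are free.\<close>

lemma openin_Kn_K_cyl:
  assumes "a \<in> Kn J m" "m \<le> n"
  shows "openin (Kn_topology J m) (K_cyl J n (perm_restrict a (J_upto J n)))"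
proof -
  define X where "X i = (if i \<le> n then {Kn_components J m a i}
                         else {p. p permutes Kn_block J m i})" for i
  have "finite {i. X i \<noteq> {p. p permutes Kn_block J m i}}"
    by (rule finite_subset[of _ "{..n}"]) (auto simp: X_def)
  moreover have "X i \<subseteq> {p. p permutes Kn_block J m i}" if "i \<ge> m" for i
    using Kn_components_in_product[OF assms(1)] that by (auto simp: X_def Kn_product_def PiE_iff)
  ultimately have "openin (Kn_product J m) (Pi\<^sub>E {m..} X)"
    unfolding Kn_product_def openin_PiE_gen
    by (auto simp: openin_discrete_topology elim: rev_finite_subset)
  moreover have "K_cyl J n (perm_restrict a (J_upto J n)) =
                   Kn_components J m -` (Pi\<^sub>E {m..} X) \<inter> Kn J m"
  proof (intro equalityI subsetI)
    fix c assume c: "c \<in> K_cyl J n (perm_restrict a (J_upto J n))"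
    then have "c \<in> Kn J m" using K_cyl_antimono[OF assms] by (auto simp: K_cyl_def)
    moreover have "Kn_components J m c i \<in> X i" if "i \<ge> m" for i
    proof (cases "i \<le> n")
      case True
      then have "Kn_block J m i \<subseteq> J_upto J n"
        using that J_subset_J_upto[of i n J] J_upto_mono[of m n J] assms
        \<comment> \<open>The level \<open>m\<close> may be 0. Then \<open>i = 0\<close> selects the
          block \<open>J_upto J 0\<close>, while every \<open>i \<ge> 1\<close> is covered by
          \<open>J_subset_J_upto\<close>.\<close>
        by (cases "i = 0") (auto simp: Kn_block_def)
      then show ?thesis using c that True
        by (auto simp: X_def Kn_components_def mem_K_cyl_iff perm_restrict_def fun_eq_iff)
    next
      case False
      then show ?thesis
        using Kn_components_in_product[OF \<open>c \<in> Kn J m\<close>] that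
        by (auto simp: X_def Kn_product_def PiE_iff)
    qed
    ultimately show "c \<in> Kn_components J m -` (Pi\<^sub>E {m..} X) \<inter> Kn J m"
      by (auto simp: PiE_iff Kn_components_def)
  next
    fix c assume "c \<in> Kn_components J m -` (Pi\<^sub>E {m..} X) \<inter> Kn J m"
    then have c: "c \<in> Kn J m" "\<And>i. i \<ge> m \<Longrightarrow> Kn_components J m c i \<in> X i" by auto
    have "c x = a x" if x: "x \<in> J_upto J n" for x
    proof -
      obtain i where i: "m \<le> i" "i \<le> n" "x \<in> Kn_block J m i"
      proof (cases "x \<in> J_upto J m")
        case True
        then show thesis using that[of m] assms(2) by (simp add: Kn_block_def)
      next
        case False
        then obtain i where "i \<in> {m<..n}" "x \<in> J i"
          using x unfolding J_upto_split[OF assms(2)] by blast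
        then show thesis using that[of i] by (simp add: Kn_block_def)
      qed
      then have "perm_restrict c (Kn_block J m i) = perm_restrict a (Kn_block J m i)"
        using c(2)[of i] by (simp add: X_def Kn_components_def)
      then show ?thesis using i(3) by (metis perm_restrict_simps(1))
    qed
    then show "c \<in> K_cyl J n (perm_restrict a (J_upto J n))"
      using c(1) assms(2) by (auto simp: mem_K_cyl_iff intro: Kn_mono)
  qed
  ultimately show ?thesis
    by (auto simp: Kn_topology_def openin_pullback_topology)
qed

text \<open>A basic open set of the product restricts only finitely many coordinates; a cylinder
  whose level bounds all of them fits inside.\<close>

lemma openin_Kn_topology_iff:
  "openin (Kn_topology J m) U \<longleftrightarrow>
     U \<subseteq> Kn J m \<and> (\<forall>a\<in>U. \<exists>n\<ge>m. K_cyl J n (perm_restrict a (J_upto J n)) \<subseteq> U)"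
proof (intro iffI conjI ballI)
  assume U: "openin (Kn_topology J m) U"
  then show "U \<subseteq> Kn J m" using openin_subset topspace_Kn_topology by metis
  fix a assume a: "a \<in> U"
  obtain V where V: "openin (Kn_product J m) V" "U = Kn_components J m -` V \<inter> Kn J m"
    using U by (auto simp: Kn_topology_def openin_pullback_topology)
  have "Kn_components J m a \<in> V" using a V by auto
  then obtain X where X0: "finite {i\<in>{m..}. X i \<noteq> topspace (discrete_topology {p. p permutes Kn_block J m i})}"
      "Kn_components J m a \<in> Pi\<^sub>E {m..} X" "Pi\<^sub>E {m..} X \<subseteq> V"
    using V(1) unfolding Kn_product_def openin_product_topology_alt by meson
  then have X: "finite {i\<in>{m..}. X i \<noteq> {p. p permutes Kn_block J m i}}"
       "Kn_components J m a \<in> Pi\<^sub>E {m..} X" "Pi\<^sub>E {m..} X \<subseteq> V"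
    by simp_all
  obtain n where n: "n \<ge> m" "\<And>i. i > n \<Longrightarrow> X i = {p. p permutes Kn_block J m i}"
  proof -
    obtain n where le_n: "\<forall>i\<in>{i\<in>{m..}. X i \<noteq> {p. p permutes Kn_block J m i}}. i \<le> n"
      using X(1) finite_nat_set_iff_bounded_le by blast
    have "X i = {p. p permutes Kn_block J m i}" if "i > max m n" for i
    proof (rule ccontr)
      assume "X i \<noteq> {p. p permutes Kn_block J m i}"
      then have "i \<le> n" using le_n that by simp
      then show False using that by simp
    qed
    then show thesis using that[of "max m n"] by simp
  qed
  have "K_cyl J n (perm_restrict a (J_upto J n)) \<subseteq> U"
  proof
    fix c assume c: "c \<in> K_cyl J n (perm_restrict a (J_upto J n))"
    have "a \<in> Kn J m" using a V by auto
    then have cm: "c \<in> Kn J m" using c K_cyl_antimono[of a J m n] n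
      by (auto simp: K_cyl_def)
    have "Kn_components J m c i \<in> X i" if i: "i \<ge> m" for i
    proof (cases "i \<le> n")
      case True
      then have "Kn_block J m i \<subseteq> J_upto J n"
        using i J_subset_J_upto[of i n J] J_upto_mono[of m n J] n
        by (cases "i = 0") (auto simp: Kn_block_def)
      then have "Kn_components J m c i = Kn_components J m a i" using c i
        by (auto simp: Kn_components_def mem_K_cyl_iff perm_restrict_def fun_eq_iff)
      then show ?thesis using X(2) i by (auto simp: PiE_iff)
    next
      case False
      then show ?thesis
        using Kn_components_in_product[OF cm] i n
        by (auto simp: Kn_product_def PiE_iff)
    qed
    then have "Kn_components J m c \<in> Pi\<^sub>E {m..} X"
      by (auto simp: PiE_iff Kn_components_def)
    then show "c \<in> U" using X V cm by auto
  qed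
  then show "\<exists>n\<ge>m. K_cyl J n (perm_restrict a (J_upto J n)) \<subseteq> U" using n by blast
next
  assume *: "U \<subseteq> Kn J m \<and> (\<forall>a\<in>U. \<exists>n\<ge>m. K_cyl J n (perm_restrict a (J_upto J n)) \<subseteq> U)"
  show "openin (Kn_topology J m) U"
  proof (subst openin_subopen, intro ballI)
    fix a assume a: "a \<in> U"
    then obtain n where n: "n \<ge> m" "K_cyl J n (perm_restrict a (J_upto J n)) \<subseteq> U" "a \<in> Kn J m"
      using * by blast
    then have "a \<in> K_cyl J n (perm_restrict a (J_upto J n))"
      by (auto simp: mem_K_cyl_iff intro: Kn_mono)
    then show "\<exists>T. openin (Kn_topology J m) T \<and> a \<in> T \<and> T \<subseteq> U"
      using n openin_Kn_K_cyl by blast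
  qed
qed

text \<open>Cylinders remain a neighbourhood base in the inductive topology, because a cylinder
  around \<open>a\<close> of high level stays inside every \<open>Kn\<close> that contains
  \<open>a\<close>.\<close>

lemma openin_K_topology_iff:
  "openin (K_topology J) U \<longleftrightarrow>
     U \<subseteq> K J \<and> (\<forall>a\<in>U. \<exists>n\<ge>1. a \<in> Kn J n \<and> K_cyl J n (perm_restrict a (J_upto J n)) \<subseteq> U)"
proof (intro iffI conjI ballI)
  assume U: "openin (K_topology J) U"
  then show "U \<subseteq> K J" by (simp add: openin_K_topology)
  fix a assume "a \<in> U"
  with \<open>U \<subseteq> K J\<close> obtain m where m: "m \<ge> 1" "a \<in> U \<inter> Kn J m" by (auto simp: K_def)
  with U have "openin (Kn_topology J m) (U \<inter> Kn J m)" by (simp add: openin_K_topology)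
  then obtain n where "n \<ge> m" "K_cyl J n (perm_restrict a (J_upto J n)) \<subseteq> U \<inter> Kn J m"
    using m unfolding openin_Kn_topology_iff by blast
  then show "\<exists>n\<ge>1. a \<in> Kn J n \<and> K_cyl J n (perm_restrict a (J_upto J n)) \<subseteq> U"
    using m Kn_mono by (intro exI[of _ n]) auto
next
  assume *: "U \<subseteq> K J \<and>
    (\<forall>a\<in>U. \<exists>n\<ge>1. a \<in> Kn J n \<and> K_cyl J n (perm_restrict a (J_upto J n)) \<subseteq> U)"
  have "openin (Kn_topology J m) (U \<inter> Kn J m)" for m
    unfolding openin_Kn_topology_iff
  proof (intro conjI ballI)
    fix a assume a: "a \<in> U \<inter> Kn J m"
    then obtain n where n: "a \<in> Kn J n" "K_cyl J n (perm_restrict a (J_upto J n)) \<subseteq> U"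
      using * by blast
    \<comment> \<open>Level at least \<open>n\<close> keeps the cylinder inside \<open>U\<close>,
      level at least \<open>m\<close> keeps it inside \<open>Kn J m\<close>.\<close>
    let ?k = "max m n"
    have "K_cyl J ?k (perm_restrict a (J_upto J ?k)) \<subseteq> U"
      using K_cyl_antimono[of a J n ?k] n by auto
    moreover have "K_cyl J ?k (perm_restrict a (J_upto J ?k)) \<subseteq> Kn J m"
      using K_cyl_antimono[of a J m ?k] a by (auto simp: K_cyl_def)
    ultimately show "\<exists>n\<ge>m. K_cyl J n (perm_restrict a (J_upto J n)) \<subseteq> U \<inter> Kn J m"
      by (intro exI[of _ ?k]) auto
  qed auto
  then show "openin (K_topology J) U" using * by (simp add: openin_K_topology)
qed

text \<open>Each element of the cylinder restricts to \<pi>, so the cylinder is itself the basic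
  neighbourhood of each of its elements.\<close>

lemma openin_K_cyl:
  assumes "n \<ge> 1"
  shows "openin (K_topology J) (K_cyl J n \<pi>)"
  unfolding openin_K_topology_iff
  using Kn_subset_K[OF assms, of J] assms by (auto simp: K_cyl_def)

lemma openin_conj_by_image:
  assumes U: "openin (K_topology J) U" and b: "b \<in> K J"
  shows "openin (K_topology J) (conj_by b ` U)"
  unfolding openin_K_topology_iff
proof (intro conjI ballI)
  have UK: "U \<subseteq> K J" using U by (simp add: openin_K_topology)
  then show "conj_by b ` U \<subseteq> K J" using b by (auto intro: conj_by_K)
  fix a' assume "a' \<in> conj_by b ` U"
  then obtain a where a: "a \<in> U" "a' = conj_by b a" by blast
  obtain m where m: "m \<ge> 1" "a \<in> Kn J m" "K_cyl J m (perm_restrict a (J_upto J m)) \<subseteq> U"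
    using U a by (auto simp: openin_K_topology_iff)
  obtain k where k: "b \<in> Kn J k" using b by (auto simp: K_def)
  \<comment> \<open>\<open>conj_by_K_cyl\<close> requires \<open>a\<close> and \<open>b\<close> at
    the same level.\<close>
  define n where "n = max m k"
  have n: "n \<ge> 1" "a \<in> Kn J n" "b \<in> Kn J n" using m k Kn_mono by (auto simp: n_def)
  have cyl: "K_cyl J n (perm_restrict a (J_upto J n)) \<subseteq> U"
    using m K_cyl_antimono[of a J m n] by (auto simp: n_def)
  have "c \<in> conj_by b ` U" if c: "c \<in> K_cyl J n (perm_restrict a' (J_upto J n))" for c
  proof -
    have "conj_by (inv b) c \<in> K_cyl J n (perm_restrict (conj_by (inv b) a') (J_upto J n))"
      using c n a by (intro conj_by_K_cyl) (auto intro: conj_by_Kn Kn_inv)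
    then have "conj_by (inv b) c \<in> U"
      using cyl a b by (auto simp: conj_by_inv_cancel K_bij)
    then show ?thesis
      using conj_by_inv_cancel(2)[OF K_bij[OF b], of c] by (metis imageI)
  qed
  then show "\<exists>n\<ge>1. a' \<in> Kn J n \<and>
               K_cyl J n (perm_restrict a' (J_upto J n)) \<subseteq> conj_by b ` U"
    using n a conj_by_Kn by blast
qed

lemma openin_G_cyl: "n \<ge> 1 \<Longrightarrow> openin (K_topology J) (G_cyl J n \<pi>)"
  unfolding G_cyl_def
  by (rule openin_Union, elim imageE, simp only:, rule openin_conj_by_image[OF openin_K_cyl])

section \<open>Density tested on cylinders, and transitive points\<close>

text \<open>The cylinders of finite permutations are open, nonempty since each contains its own
  \<pi>, and one of them lies inside every nonempty open set.\<close>

lemma dense_in_K_iff: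
  assumes "A \<subseteq> K J"
  shows "dense_in (K_topology J) A \<longleftrightarrow>
           (\<forall>n\<ge>1. \<forall>\<pi>\<in>S_upto J n. A \<inter> K_cyl J n \<pi> \<noteq> {})"
proof
  assume "dense_in (K_topology J) A"
  then have cl: "K_topology J closure_of A = topspace (K_topology J)" by (simp add: dense_in_def)
  show "\<forall>n\<ge>1. \<forall>\<pi>\<in>S_upto J n. A \<inter> K_cyl J n \<pi> \<noteq> {}"
  proof (intro allI ballI impI)
    fix n \<pi> assume "n \<ge> 1" "\<pi> \<in> S_upto J n"
    then have "openin (K_topology J) (K_cyl J n \<pi>)" "K_cyl J n \<pi> \<noteq> {}"
      using openin_K_cyl S_upto_in_K_cyl by blast+
    then show "A \<inter> K_cyl J n \<pi> \<noteq> {}"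
      using cl unfolding dense_intersects_open by blast
  qed
next
  assume *: "\<forall>n\<ge>1. \<forall>\<pi>\<in>S_upto J n. A \<inter> K_cyl J n \<pi> \<noteq> {}"
  have "A \<inter> U \<noteq> {}" if U: "openin (K_topology J) U" "U \<noteq> {}" for U
  proof -
    obtain n a where "n \<ge> 1" "a \<in> Kn J n" "K_cyl J n (perm_restrict a (J_upto J n)) \<subseteq> U"
      using U unfolding openin_K_topology_iff by blast
    then show ?thesis using * perm_restrict_in_S_upto by blast
  qed
  then show "dense_in (K_topology J) A"
    using assms unfolding dense_in_def dense_intersects_open
    by (simp add: topspace_K_topology Int_commute)
qed

lemma T_set_subset_K: "T_set J \<subseteq> K J"
proof -
  have "id \<in> S_upto J 1" by (simp add: S_upto_def permutes_id)
  then show ?thesis using G_cyl_subset_K[of 1 J id] by (fastforce simp: T_set_def)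
qed

text \<open>By \<open>mem_G_cyl_iff\<close> and \<open>dense_in_K_iff\<close>, both sides say that
  the conjugacy class of \<open>a\<close> meets every cylinder.\<close>

lemma T_set_eq_transitive_points: "T_set J = transitive_points (K_topology J) (K J) conj_by"
proof -
  have "a \<in> T_set J \<longleftrightarrow> dense_in (K_topology J) ((\<lambda>b. conj_by b a) ` K J)" if a: "a \<in> K J" for a
  proof -
    have "(\<lambda>b. conj_by b a) ` K J \<subseteq> K J" using a conj_by_K by blast
    then show ?thesis
      by (simp only: dense_in_K_iff T_set_def INT_iff atLeast_iff Ball_def mem_G_cyl_iff[OF a]) blast
  qed
  then show ?thesis
    using T_set_subset_K by (auto simp: transitive_points_def topspace_K_topology)
qed

section \<open>From a copy of a permutation to a conjugate in its cylinder\<close>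

text \<open>The delicate point is that the conjugate lies in \<open>Kn J n\<close> itself and not
  only in a later level. The assumption on \<open>a\<close> gives this, since \<open>a\<close> then
  preserves \<open>J_upto J n\<close> and each later block.\<close>

lemma contains_copy_imp_conj:
  assumes a: "a \<in> Kn J n" and \<pi>: "\<pi> \<in> S_upto J n" and copy: "contains_copy J n a \<pi>"
  shows "\<exists>b\<in>K J. conj_by b a \<in> K_cyl J n \<pi>"
proof -
  obtain k \<beta> where k: "k \<ge> 1" and inj: "inj_on \<beta> (J_upto J n)"
    and sub: "\<beta> ` J_upto J n \<subseteq> J (n + k)"
    and eq: "\<And>x. x \<in> J_upto J n \<Longrightarrow> \<beta> (\<pi> x) = a (\<beta> x)"
    using copy unfolding contains_copy_def by blast
  let ?A = "J_upto J n" and ?B = "J (n + k)"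
  have disj: "?A \<inter> J i = {}" if "i > n" for i using that by (rule J_upto_disjoint)
  have perm: "\<pi> permutes ?A" using \<pi> by (simp add: S_upto_def)
  \<comment> \<open>The involution exchanges \<open>x\<close> with \<open>\<beta> x\<close> and
    fixes all other points; its two supports are disjoint because \<open>k \<ge> 1\<close>.\<close>
  define b where
    "b x = (if x \<in> ?A then \<beta> x else if x \<in> \<beta> ` ?A then inv_into ?A \<beta> x else x)" for x
  have b\<beta>: "b (\<beta> x) = x" if "x \<in> ?A" for x
  proof -
    have "\<beta> x \<in> ?B" using sub that by blast
    moreover have "?A \<inter> ?B = {}" using k by (intro disj) simp
    ultimately have "\<beta> x \<notin> ?A" by blast
    then show ?thesis using that inj by (simp add: b_def)
  qed
  have bb: "b (b x) = x" for x
  proof -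
    consider "x \<in> ?A" | y where "y \<in> ?A" "x = \<beta> y" | "x \<notin> ?A" "x \<notin> \<beta> ` ?A" by blast
    then show ?thesis
    proof cases
      case 1 then show ?thesis using b\<beta>[OF 1] by (simp add: b_def)
    next
      case 2 then show ?thesis using b\<beta>[OF 2(1)] by (simp add: b_def)
    next
      case 3 then show ?thesis by (simp add: b_def)
    qed
  qed
  have "b \<circ> b = id" by (simp add: fun_eq_iff bb)
  then have bij: "bij b" and inv: "inv b = b" by (auto intro: o_bij inv_unique_comp)
  \<comment> \<open>For an involution, mapping a set into itself already means mapping it onto
    itself.\<close>
  have stable: "b ` C = C" if "\<And>x. x \<in> C \<Longrightarrow> b x \<in> C" for C
    using that by (metis bb image_subsetI image_eqI subsetI subset_antisym)
  have b_AB: "b x \<in> ?A \<union> ?B" if "x \<in> ?A \<union> ?B" for x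
    using that sub inv_into_into[of x \<beta> ?A] by (auto simp: b_def)
  have b_other: "b x = x" if "x \<notin> ?A" "x \<notin> ?B" for x using that sub by (auto simp: b_def)
  have "?A \<union> ?B \<subseteq> J_upto J (n + k)"
    using J_upto_mono[of n "n + k" J] J_subset_J_upto[of "n + k" "n + k" J] k by auto
  then have "b ` J_upto J (n + k) = J_upto J (n + k)"
    using b_AB b_other by (intro stable) (metis UnCI subsetD)
  moreover have "b ` J i = J i" if "i > n + k" for i
  proof (rule stable)
    fix x assume "x \<in> J i"
    moreover have "?A \<inter> J i = {}" "J i \<inter> ?B = {}"
      using disj[of i] J_disjoint[of i "n + k"] that k by simp_all
    ultimately have "b x = x" by (intro b_other) auto
    then show "b x \<in> J i" using \<open>x \<in> J i\<close> by simp
  qed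
  ultimately have "b \<in> Kn J (n + k)" using bij by (simp add: Kn_def)
  then have bK: "b \<in> K J" using Kn_subset_K[of "n + k" J] k by auto
  let ?c = "conj_by b a"
  have c: "?c = b \<circ> a \<circ> b" by (simp add: conj_by_def inv)
  have c\<pi>: "?c x = \<pi> x" if "x \<in> ?A" for x
  proof -
    \<comment> \<open>Here \<open>b\<close> moves \<open>x\<close> to \<open>\<beta> x\<close>, and
      \<open>a\<close> carries that point to \<open>\<beta> (\<pi> x)\<close> by the copy
      equation.\<close>
    have "?c x = b (\<beta> (\<pi> x))" using that eq by (simp add: c b_def)
    then show ?thesis using b\<beta> permutes_in_image[OF perm] that by simp
  qed
  have cA: "?c ` ?A = ?A" using c\<pi> permutes_image[OF perm] by (metis image_cong)
  have bijc: "bij ?c" using bij a by (auto simp: c Kn_def intro!: bij_comp)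
  have "?c ` J i = J i" if i: "i > n" for i
  proof (cases "i = n + k")
    case True
    \<comment> \<open>On the block that is swapped into, \<open>b\<close> alone does not preserve
      \<open>?B\<close> in general. The conjugate preserves \<open>?A \<union> ?B\<close> and
      \<open>?A\<close>, hence by injectivity the difference \<open>?B\<close>.\<close>
    have "b ` (?A \<union> ?B) = ?A \<union> ?B" using b_AB by (rule stable)
    moreover have "a ` (?A \<union> ?B) = ?A \<union> ?B" using a k by (simp add: Kn_def image_Un)
    ultimately have "?c ` (?A \<union> ?B) = ?A \<union> ?B"
      unfolding c by (intro comp_image_eq)
    then have "?c ` (?A \<union> ?B - ?A) = ?A \<union> ?B - ?A"
      using cA bijc by (metis bij_def image_set_diff)
    moreover have "?A \<union> ?B - ?A = ?B" using disj[of "n + k"] k by auto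
    ultimately show ?thesis using True by simp
  next
    case False
    then have "J i \<inter> ?B = {}" using J_disjoint i k by auto
    then have "b x = x" if "x \<in> J i" for x using that disj[OF i] by (intro b_other) auto
    then have "b ` J i = J i" by simp
    moreover have "a ` J i = J i" using a i by (simp add: Kn_def)
    ultimately show ?thesis unfolding c by (intro comp_image_eq)
  qed
  then have "?c \<in> Kn J n" using bijc cA by (simp add: Kn_def)
  then have "?c \<in> K_cyl J n (perm_restrict \<pi> ?A)" using c\<pi> by (simp add: mem_K_cyl_iff)
  then show ?thesis using bK \<pi> by (auto simp: perm_restrict_S_upto)
qed

lemma all_copies_imp_T_set:
  assumes a: "a \<in> K J" and copies: "\<And>n \<pi>. n \<ge> 1 \<Longrightarrow> \<pi> \<in> S_upto J n \<Longrightarrow> contains_copy J n a \<pi>"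
  shows "a \<in> T_set J"
proof -
  obtain m where m: "m \<ge> 1" "a \<in> Kn J m" using a by (auto simp: K_def)
  have "a \<in> G_cyl J n \<pi>" if n: "n \<ge> 1" "\<pi> \<in> S_upto J n" for n \<pi>
  proof -
    let ?k = "max m n"
    \<comment> \<open>As a need not lie in Kn J n, pass to a level that also contains a.\<close>
    have "\<pi> \<in> S_upto J ?k" using n S_upto_mono[of n ?k J] by auto
    moreover have "a \<in> Kn J ?k" using m Kn_mono by (metis max.cobounded1)
    ultimately have "\<exists>b\<in>K J. conj_by b a \<in> K_cyl J ?k \<pi>"
      using copies[of ?k \<pi>] m by (intro contains_copy_imp_conj) auto
    \<comment> \<open>The cylinder of \<pi> at level \<open>?k\<close> lies inside its cylinder at
      level \<open>n\<close>.\<close>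
    then show ?thesis
      using K_cyl_S_upto_antimono[OF n(2), of ?k] mem_G_cyl_iff[OF a] by auto
  qed
  then show ?thesis by (simp add: T_set_def)
qed

section \<open>An element containing copies of all finite permutations\<close>

text \<open>The countably many pairs of a level and a permutation are scheduled along the blocks.
  Block \<open>i\<close> realises the pair \<open>e i\<close> whenever it is large enough, and the
  block permutations are glued into one element of \<open>Kn J 1\<close>.\<close>

lemma ex_all_copies:
  "\<exists>a\<in>K J. \<forall>n\<ge>1. \<forall>\<pi>\<in>S_upto J n. contains_copy J n a \<pi>"
proof -
  define copied where "copied i \<sigma> n \<pi> \<longleftrightarrow>
    (\<exists>\<beta>. inj_on \<beta> (J_upto J n) \<and> \<beta> ` J_upto J n \<subseteq> J i \<and>
         (\<forall>x\<in>J_upto J n. \<beta> (\<pi> x) = (\<sigma> :: nat \<Rightarrow> nat) (\<beta> x)))" for i \<sigma> n \<pi>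
  have ex: "\<exists>\<sigma>. \<sigma> permutes J i \<and> (card (J_upto J n) \<le> card (J i) \<longrightarrow> copied i \<sigma> n \<pi>)"
    if i: "i \<ge> 1" and \<pi>: "\<pi> \<in> S_upto J n" for i n \<pi>
  proof (cases "card (J_upto J n) \<le> card (J i)")
    case False
    \<comment> \<open>On a block that is too small, the identity serves as filler.\<close>
    then show ?thesis using permutes_id by blast
  next
    case True
    have "finite (J i)" using J i by (simp add: block_partition_def)
    then obtain \<beta> where \<beta>: "\<beta> ` J_upto J n \<subseteq> J i" "inj_on \<beta> (J_upto J n)"
      using True finite_J_upto by (metis card_le_inj)
    have perm: "\<pi> permutes J_upto J n" using \<pi> by (simp add: S_upto_def)
    \<comment> \<open>This is \<pi> transported along \<beta>, extended by the identity.\<close>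
    define \<sigma> where "\<sigma> y = (if y \<in> \<beta> ` J_upto J n
      then \<beta> (\<pi> (inv_into (J_upto J n) \<beta> y)) else y)" for y
    have \<sigma>: "\<sigma> (\<beta> x) = \<beta> (\<pi> x)" if "x \<in> J_upto J n" for x using that \<beta> by (simp add: \<sigma>_def)
    have "\<sigma> ` \<beta> ` J_upto J n = \<beta> ` \<pi> ` J_upto J n" using \<sigma> by (auto simp: image_iff)
    then have img: "\<sigma> ` \<beta> ` J_upto J n = \<beta> ` J_upto J n" using permutes_image[OF perm] by simp
    have "bij_betw \<sigma> (\<beta> ` J_upto J n) (\<beta> ` J_upto J n)"
      using img finite_J_upto by (simp add: bij_betw_def eq_card_imp_inj_on)
    then have "\<sigma> permutes \<beta> ` J_upto J n"
      by (rule bij_imp_permutes) (simp add: \<sigma>_def)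
    then have "\<sigma> permutes J i" using \<beta>(1) by (rule permutes_subset)
    moreover have "copied i \<sigma> n \<pi>" using \<beta> \<sigma> by (auto simp: copied_def)
    ultimately show ?thesis by blast
  qed
  define P where "P = Sigma {1..} (S_upto J)"
  \<comment> \<open>Nonemptiness of \<open>P\<close> ensures that \<open>from_nat_into P\<close>
    takes values in \<open>P\<close>.\<close>
  have idP: "(1, id) \<in> P" by (simp add: P_def S_upto_def permutes_id)
  have "countable P"
    unfolding P_def S_upto_def
    by (intro countable_SIGMA countable_finite[OF finite_permutations] finite_J_upto) simp
  \<comment> \<open>Every pair is attained infinitely often, hence also at blocks that are large enough.\<close>
  define e where "e i = from_nat_into P (fst (prod_decode i))" for i
  have eP: "e i \<in> P" for i using idP by (auto simp: e_def intro!: from_nat_into)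
  \<comment> \<open>The second component of the decoded pair is free; choosing it as
    \<open>N\<close> pushes the index to at least \<open>N\<close>.\<close>
  have e_late: "\<exists>i\<ge>N. e i = p" if "p \<in> P" for p N
  proof (intro exI conjI)
    show "N \<le> prod_encode (to_nat_on P p, N)" by (rule le_prod_encode_2)
    show "e (prod_encode (to_nat_on P p, N)) = p"
      using \<open>countable P\<close> that by (simp add: e_def)
  qed
  have "\<forall>i\<in>{1..}. \<exists>\<sigma>. \<sigma> permutes J i \<and>
          (card (J_upto J (fst (e i))) \<le> card (J i) \<longrightarrow> copied i \<sigma> (fst (e i)) (snd (e i)))"
  proof (intro ballI ex)
    fix i show "snd (e i) \<in> S_upto J (fst (e i))"
      using eP[of i] unfolding P_def by (metis SigmaE fst_conv snd_conv)
  qed auto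
  then obtain \<sigma> where "\<forall>i\<in>{1..}. \<sigma> i permutes J i \<and>
      (card (J_upto J (fst (e i))) \<le> card (J i) \<longrightarrow> copied i (\<sigma> i) (fst (e i)) (snd (e i)))"
    unfolding bchoice_iff by blast
  then have \<sigma>: "\<And>i. i \<ge> 1 \<Longrightarrow> \<sigma> i permutes J i"
    "\<And>i. i \<ge> 1 \<Longrightarrow> card (J_upto J (fst (e i))) \<le> card (J i) \<Longrightarrow>
       copied i (\<sigma> i) (fst (e i)) (snd (e i))"
    by simp_all
  \<comment> \<open>At level 1 the factors are exactly the single blocks, so surjectivity of
    \<open>Kn_components J 1\<close> glues any family of block permutations.\<close>
  have block: "Kn_block J 1 i = J i" for i by (simp add: Kn_block_def J_upto_def)
  have "restrict \<sigma> {1..} \<in> topspace (Kn_product J 1)"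
    using \<sigma>(1) by (simp add: Kn_product_def block del: One_nat_def)
  then obtain a where a: "a \<in> Kn J 1" "Kn_components J 1 a = restrict \<sigma> {1..}"
    using homeomorphic_imp_surjective_map[OF homeomorphic_map_Kn[OF J le_refl]]
    unfolding topspace_Kn_topology by (metis (no_types, lifting) imageE)
  have a\<sigma>: "a x = \<sigma> i x" if "i \<ge> 1" "x \<in> J i" for i x
    using fun_cong[OF fun_cong[OF a(2), of i], of x] that
    by (simp add: Kn_components_def block perm_restrict_def del: One_nat_def)
  have "contains_copy J n a \<pi>" if n: "n \<ge> 1" "\<pi> \<in> S_upto J n" for n \<pi>
  proof -
    \<comment> \<open>The bound \<open>Suc n\<close> makes the offset \<open>i - n\<close> at least
      1; the cardinality bound, through \<open>le_card_J\<close>, makes block \<open>i\<close> large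
      enough.\<close>
    obtain i where i: "i \<ge> max (Suc n) (card (J_upto J n))" "e i = (n, \<pi>)"
      using e_late[of "(n, \<pi>)" "max (Suc n) (card (J_upto J n))"] n by (auto simp: P_def)
    then have "card (J_upto J n) \<le> card (J i)" using le_card_J[of i] by simp
    then have "copied i (\<sigma> i) n \<pi>" using \<sigma>(2)[of i] i by simp
    then obtain \<beta> where \<beta>: "inj_on \<beta> (J_upto J n)" "\<beta> ` J_upto J n \<subseteq> J i"
      "\<forall>x\<in>J_upto J n. \<beta> (\<pi> x) = \<sigma> i (\<beta> x)"
      by (auto simp: copied_def)
    then have "\<forall>x\<in>J_upto J n. \<beta> (\<pi> x) = a (\<beta> x)" using a\<sigma>[of i] i by auto
    then show ?thesis
      unfolding contains_copy_def using \<beta> i by (intro exI[of _ "i - n"] exI[of _ \<beta>]) auto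
  qed
  then show ?thesis using a Kn_subset_K[of 1 J] by auto
qed

section \<open>The remaining properties of \<open>T_set\<close>, and the Rohlin property\<close>

lemma gdelta_in_T_set: "gdelta_in (K_topology J) (T_set J)"
proof -
  \<comment> \<open>An empty intersection would be the whole function type instead of a subset of
    \<open>K J\<close>.\<close>
  have ne: "S_upto J n \<noteq> {}" for n
    by (auto simp: S_upto_def intro: permutes_id)
  have fin: "finite (S_upto J n)" for n
    by (simp add: S_upto_def finite_J_upto finite_permutations)
  have "gdelta_in (K_topology J) (\<Inter>\<pi>\<in>S_upto J n. G_cyl J n \<pi>)" if "n \<ge> 1" for n
    using that ne[of n] fin[of n]
    by (intro gdelta_in_Inter) (auto intro!: open_imp_gdelta_in openin_G_cyl countable_finite)
  then show ?thesis
    unfolding T_set_def by (intro gdelta_in_Inter) auto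
qed

lemma dense_in_T_set: "dense_in (K_topology J) (T_set J)"
proof -
  obtain a where a: "a \<in> K J" "a \<in> T_set J" using ex_all_copies all_copies_imp_T_set by blast
  have "dense_in (K_topology J) ((\<lambda>b. conj_by b a) ` K J)"
    using a(2) by (simp add: T_set_eq_transitive_points transitive_points_def)
  moreover have sub: "(\<lambda>b. conj_by b a) ` K J \<subseteq> T_set J"
  proof
    fix c assume "c \<in> (\<lambda>b. conj_by b a) ` K J"
    then obtain b where b: "b \<in> K J" "c = conj_by b a" by blast
    have "c \<in> G_cyl J n \<pi>" if "n \<ge> 1" "\<pi> \<in> S_upto J n" for n \<pi>
      using a(2) that G_cyl_conj_invariant[OF b(1), of n \<pi>] b(2) by (auto simp: T_set_def)
    then show "c \<in> T_set J" by (simp add: T_set_def)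
  qed
  ultimately show ?thesis
    using T_set_subset_K unfolding dense_in_K_iff[OF order_trans[OF sub T_set_subset_K]]
      dense_in_K_iff[OF T_set_subset_K] by blast
qed

text \<open>Density passes from the intersection \<open>T_set\<close> up to each set being
  intersected.\<close>

lemma dense_in_G_cyl:
  assumes "n \<ge> 1" "\<pi> \<in> S_upto J n"
  shows "dense_in (K_topology J) (G_cyl J n \<pi>)"
proof -
  have "T_set J \<subseteq> G_cyl J n \<pi>" using assms by (auto simp: T_set_def)
  then show ?thesis
    using dense_in_T_set unfolding dense_in_K_iff[OF T_set_subset_K]
      dense_in_K_iff[OF G_cyl_subset_K[OF assms(1)]] by blast
qed

lemma rohlin_property_K: "rohlin_property J"
proof -
  obtain a where "a \<in> K J" "a \<in> T_set J" using ex_all_copies all_copies_imp_T_set by blast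
  then show ?thesis
    by (auto simp: rohlin_property_def T_set_eq_transitive_points transitive_points_def)
qed

end

theorem theorem4p4:
  fixes J :: "nat \<Rightarrow> nat set"
  assumes "block_partition J"
  shows "(\<forall>n\<ge>1. \<forall>\<pi>\<in>S_upto J n.
            openin (K_topology J) (G_cyl J n \<pi>) \<and>
            dense_in (K_topology J) (G_cyl J n \<pi>) \<and>
            (\<forall>b\<in>K J. conj_by b ` G_cyl J n \<pi> = G_cyl J n \<pi>)) \<and>
         gdelta_in (K_topology J) (T_set J) \<and>
         dense_in (K_topology J) (T_set J) \<and>
         T_set J = transitive_points (K_topology J) (K J) conj_by \<and>
         (\<forall>a\<in>K J. (\<forall>n\<ge>1. \<forall>\<pi>\<in>S_upto J n. contains_copy J n a \<pi>) \<longrightarrow> a \<in> T_set J) \<and>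
         rohlin_property J"
  using openin_G_cyl[OF assms] dense_in_G_cyl[OF assms] G_cyl_conj_invariant
    gdelta_in_T_set[OF assms] dense_in_T_set[OF assms] T_set_eq_transitive_points[OF assms]
    all_copies_imp_T_set[OF assms] rohlin_property_K[OF assms]
  by simp

end
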